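(* Let $(E\xrightarrow{\delta}G\to1,\{\,,\,\})$ be a braided crossed module such that $\delta$ is surjective, and let $x\in G$. Define $\Phi^x=(\psi^x,\phi^x)$, with $\psi^x,\phi^x\colon G\times G\to E$, by $$\phi^x(L,M)=\{Mx^{-1},Lx^{-1}\},\qquad\psi^x(L,M)=\{L,M\}\,\{ML^{-1},x\}.$$ Then $\Phi^x$ is an unframed Reidemeister pair for the crossed module $(\delta\colon E\to G,\triangleright')$, where $g\triangleright' k=k\{\delta(k)^{-1},g\}$, and it constitutes an unframed Eisermann lifting for this crossed module.
   Context: $[a,b]=aba^{-1}b^{-1}$. A braided crossed module $(E\xrightarrow{\delta}G\to1,\{\,,\,\})$ is a 2-crossed module whose last group is trivial; explicitly: a group morphism $\delta\colon E\to G$ and a map $\{\,,\,\}\colon G\times G\to E$ such that for all $e,f,g\in G$, $k,l\in E$: $\delta(\{e,f\})=[e,f]$; $\{\delta(l),\delta(k)\}=[l,k]$; $\{\delta(l),e\}\{e,\delta(l)\}=1$; $\{ef,g\}=\{e,fgf^{-1}\}\{f,g\}$; $\{e,fg\}=\{e,f\}\,(f\triangleright'\{e,g\})$, where $e\triangleright' l:=l\{\delta(l)^{-1},e\}$. It is known that $\triangleright'$ is a left action of $G$ on $E$ by automorphisms and that $(\delta\colon E\to G,\triangleright')$ is a crossed module. For a crossed module $(\mu\colon P\to H,\cdot)$ (group morphism $\mu$ with left action of $H$ on $P$ by automorphisms, $\mu(g\cdot e)=g\mu(e)g^{-1}$, $\mu(e)\cdot f=efe^{-1}$), functions $\psi,\phi\colon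 H\times H\to P$ form an unframed Reidemeister pair if for all $X,Y,T\in H$: (R1) $\psi(X,X)=1$; (R2) $\phi(X,Y)\psi(X,Z)=1$, where $Z=X^{-1}\mu(\phi(X,Y))^{-1}YX$; (R3) $\phi(Y,X)(Y\cdot\phi(T,Z))\phi(T,Y)=(X\cdot\phi(T,Y))\phi(T,X)(T\cdot\phi(V,W))$, where $Z=Y^{-1}\mu(\phi(Y,X))^{-1}XY$, $V=T^{-1}\mu(\phi(T,Y))^{-1}YT$, $W=T^{-1}\mu(\phi(T,X))^{-1}XT$. An unframed Eisermann lifting (for $x\in H$) is a crossed module $(\mu\colon P\to H,\cdot)$ with an unframed Reidemeister pair $(\psi^x,\phi^x)$ such that $\mu(\phi^x(L,M))=[Mx^{-1},Lx^{-1}]$ and $\mu(\psi^x(L,M))=[L,M][ML^{-1},x]$ for all $L,M\in H$. *)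

theory Defs
  imports "HOL-Algebra.Bij"
begin

definition commutator :: "('a, 'c) monoid_scheme \<Rightarrow> 'a \<Rightarrow> 'a \<Rightarrow> 'a" where
  "commutator G a b = a \<otimes>\<^bsub>G\<^esub> b \<otimes>\<^bsub>G\<^esub> inv\<^bsub>G\<^esub> a \<otimes>\<^bsub>G\<^esub> inv\<^bsub>G\<^esub> b"

text \<open>The elements of \<^term>\<open>AutoGroup P\<close> are extensional functions, hence the restriction
  of \<open>act h\<close> to the carrier of \<open>P\<close> in the assumption \<open>act_hom\<close>.\<close>

locale crossed_module = group_hom P H mu
  for P :: "('p, 'm) monoid_scheme" and H :: "('h, 'n) monoid_scheme" and mu :: "'p \<Rightarrow> 'h" +
  fixes act :: "'h \<Rightarrow> 'p \<Rightarrow> 'p"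
  assumes act_hom: "(\<lambda>h. restrict (act h) (carrier P)) \<in> hom H (AutoGroup P)"
    and equivariant: "\<lbrakk>g \<in> carrier H; e \<in> carrier P\<rbrakk> \<Longrightarrow>
      mu (act g e) = g \<otimes>\<^bsub>H\<^esub> mu e \<otimes>\<^bsub>H\<^esub> inv\<^bsub>H\<^esub> g"
    and peiffer: "\<lbrakk>e \<in> carrier P; f \<in> carrier P\<rbrakk> \<Longrightarrow>
      act (mu e) f = e \<otimes>\<^bsub>P\<^esub> f \<otimes>\<^bsub>P\<^esub> inv\<^bsub>P\<^esub> e"

text \<open>The action \<open>e \<triangleright>' l = l {\<delta>(l)\<inverse>, e}\<close> of \<open>G\<close> on \<open>E\<close> derived from a braiding.\<close>

definition braided_act ::
  "('e, 'm) monoid_scheme \<Rightarrow> ('g, 'n) monoid_scheme \<Rightarrow> ('e \<Rightarrow> 'g) \<Rightarrow> ('g \<Rightarrow> 'g \<Rightarrow> 'e) \<Rightarrow> 'g \<Rightarrow> 'e \<Rightarrow> 'e"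
  where "braided_act E G \<delta> br e l = l \<otimes>\<^bsub>E\<^esub> br (inv\<^bsub>G\<^esub> (\<delta> l)) e"

locale braided_crossed_module = group_hom E G \<delta>
  for E :: "('e, 'm) monoid_scheme" and G :: "('g, 'n) monoid_scheme" and \<delta> :: "'e \<Rightarrow> 'g" +
  fixes br :: "'g \<Rightarrow> 'g \<Rightarrow> 'e"
  assumes br_closed: "br \<in> carrier G \<rightarrow> carrier G \<rightarrow> carrier E"
    and delta_br: "\<lbrakk>e \<in> carrier G; f \<in> carrier G\<rbrakk> \<Longrightarrow> \<delta> (br e f) = commutator G e f"
    and br_delta: "\<lbrakk>l \<in> carrier E; k \<in> carrier E\<rbrakk> \<Longrightarrow> br (\<delta> l) (\<delta> k) = commutator E l k"
    and br_delta_inverse: "\<lbrakk>l \<in> carrier E; e \<in> carrier G\<rbrakk> \<Longrightarrow>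
      br (\<delta> l) e \<otimes>\<^bsub>E\<^esub> br e (\<delta> l) = \<one>\<^bsub>E\<^esub>"
    and br_mult_left: "\<lbrakk>e \<in> carrier G; f \<in> carrier G; g \<in> carrier G\<rbrakk> \<Longrightarrow>
      br (e \<otimes>\<^bsub>G\<^esub> f) g = br e (f \<otimes>\<^bsub>G\<^esub> g \<otimes>\<^bsub>G\<^esub> inv\<^bsub>G\<^esub> f) \<otimes>\<^bsub>E\<^esub> br f g"
    and br_mult_right: "\<lbrakk>e \<in> carrier G; f \<in> carrier G; g \<in> carrier G\<rbrakk> \<Longrightarrow>
      br e (f \<otimes>\<^bsub>G\<^esub> g) = br e f \<otimes>\<^bsub>E\<^esub> braided_act E G \<delta> br f (br e g)"

text \<open>The element \<open>X\<inverse> mu(p)\<inverse> Y X\<close> of \<open>H\<close>, which with \<open>p = \<phi>(X,Y)\<close> occurs in the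
  Reidemeister conditions.\<close>

definition crossing_arc ::
  "('h, 'n) monoid_scheme \<Rightarrow> ('p \<Rightarrow> 'h) \<Rightarrow> 'p \<Rightarrow> 'h \<Rightarrow> 'h \<Rightarrow> 'h" where
  "crossing_arc H mu p X Y =
     inv\<^bsub>H\<^esub> X \<otimes>\<^bsub>H\<^esub> inv\<^bsub>H\<^esub> (mu p) \<otimes>\<^bsub>H\<^esub> Y \<otimes>\<^bsub>H\<^esub> X"

locale unframed_Reidemeister_pair = crossed_module P H mu act
  for P :: "('p, 'm) monoid_scheme" and H :: "('h, 'n) monoid_scheme" and mu :: "'p \<Rightarrow> 'h"
    and act :: "'h \<Rightarrow> 'p \<Rightarrow> 'p" +
  fixes \<psi> \<phi> :: "'h \<Rightarrow> 'h \<Rightarrow> 'p"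
  assumes psi_closed: "\<psi> \<in> carrier H \<rightarrow> carrier H \<rightarrow> carrier P"
    and phi_closed: "\<phi> \<in> carrier H \<rightarrow> carrier H \<rightarrow> carrier P"
    and R1: "X \<in> carrier H \<Longrightarrow> \<psi> X X = \<one>\<^bsub>P\<^esub>"
    and R2: "\<lbrakk>X \<in> carrier H; Y \<in> carrier H; Z = crossing_arc H mu (\<phi> X Y) X Y\<rbrakk> \<Longrightarrow>
      \<phi> X Y \<otimes>\<^bsub>P\<^esub> \<psi> X Z = \<one>\<^bsub>P\<^esub>"
    and R3: "\<lbrakk>X \<in> carrier H; Y \<in> carrier H; T \<in> carrier H;
        Z = crossing_arc H mu (\<phi> Y X) Y X;
        V = crossing_arc H mu (\<phi> T Y) T Y;
        W = crossing_arc H mu (\<phi> T X) T X\<rbrakk> \<Longrightarrow>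
      \<phi> Y X \<otimes>\<^bsub>P\<^esub> act Y (\<phi> T Z) \<otimes>\<^bsub>P\<^esub> \<phi> T Y =
      act X (\<phi> T Y) \<otimes>\<^bsub>P\<^esub> \<phi> T X \<otimes>\<^bsub>P\<^esub> act T (\<phi> V W)"

locale unframed_Eisermann_lifting = unframed_Reidemeister_pair P H mu act \<psi> \<phi>
  for P :: "('p, 'm) monoid_scheme" and H :: "('h, 'n) monoid_scheme" and mu :: "'p \<Rightarrow> 'h"
    and act :: "'h \<Rightarrow> 'p \<Rightarrow> 'p" and \<psi> \<phi> :: "'h \<Rightarrow> 'h \<Rightarrow> 'p" +
  fixes x :: 'h
  assumes x_closed: "x \<in> carrier H"
    and mu_phi: "\<lbrakk>L \<in> carrier H; M \<in> carrier H\<rbrakk> \<Longrightarrow>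
      mu (\<phi> L M) = commutator H (M \<otimes>\<^bsub>H\<^esub> inv\<^bsub>H\<^esub> x) (L \<otimes>\<^bsub>H\<^esub> inv\<^bsub>H\<^esub> x)"
    and mu_psi: "\<lbrakk>L \<in> carrier H; M \<in> carrier H\<rbrakk> \<Longrightarrow>
      mu (\<psi> L M) = commutator H L M \<otimes>\<^bsub>H\<^esub> commutator H (M \<otimes>\<^bsub>H\<^esub> inv\<^bsub>H\<^esub> L) x"

definition braided_phi ::
  "('g, 'n) monoid_scheme \<Rightarrow> ('g \<Rightarrow> 'g \<Rightarrow> 'e) \<Rightarrow> 'g \<Rightarrow> 'g \<Rightarrow> 'g \<Rightarrow> 'e" where
  "braided_phi G br x L M = br (M \<otimes>\<^bsub>G\<^esub> inv\<^bsub>G\<^esub> x) (L \<otimes>\<^bsub>G\<^esub> inv\<^bsub>G\<^esub> x)"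

definition braided_psi ::
  "('e, 'm) monoid_scheme \<Rightarrow> ('g, 'n) monoid_scheme \<Rightarrow> ('g \<Rightarrow> 'g \<Rightarrow> 'e) \<Rightarrow> 'g \<Rightarrow> 'g \<Rightarrow> 'g \<Rightarrow> 'e" where
  "braided_psi E G br x L M = br L M \<otimes>\<^bsub>E\<^esub> br (M \<otimes>\<^bsub>G\<^esub> inv\<^bsub>G\<^esub> L) x"

end

theory Submission
  imports Defs
begin

text \<open>Surjectivity of \<open>\<delta>\<close> allows every element of \<open>G\<close> to be lifted to \<open>E\<close>. On images of \<open>\<delta>\<close> the
  braiding is the commutator of \<open>E\<close> and the derived action is conjugation in \<open>E\<close>, so the crossed
  module axioms and the Reidemeister conditions all become word identities in the single
  group \<open>E\<close>.\<close>

lemma (in group) mult_inv_cancel_left: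
  "\<lbrakk>a \<in> carrier G; b \<in> carrier G\<rbrakk> \<Longrightarrow> a \<otimes> (inv a \<otimes> b) = b"
  "\<lbrakk>a \<in> carrier G; b \<in> carrier G\<rbrakk> \<Longrightarrow> inv a \<otimes> (a \<otimes> b) = b"
  by (simp_all add: m_assoc [symmetric])

text \<open>Together with the default simp rules for units and inverses, these form a complete
  rewriting system for free groups: products associate to the right, inverses move onto letters, and
  the cancellation rules reach inverse neighbours inside a longer product. Thus \<open>simp\<close>
  settles every word identity valid in all groups.\<close>

lemmas (in group) word_simps = m_assoc inv_mult_group mult_inv_cancel_left commutator_def

lemma (in group) commutator_closed [simp]:
  "\<lbrakk>a \<in> carrier G; b \<in> carrier G\<rbrakk> \<Longrightarrow> commutator G a b \<in> carrier G"
  by (simp add: commutator_def)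

text \<open>The left side is the formula of \<open>braided_act\<close> with \<open>br\<close>
  replaced by the commutator.\<close>

lemma (in group) conjugation_eq_mult_commutator:
  assumes "a \<in> carrier G" "b \<in> carrier G"
  shows "b \<otimes> commutator G (inv b) a = a \<otimes> b \<otimes> inv a"
  using assms by (simp add: word_simps)

lemma (in group) conjugation_in_auto:
  assumes a: "a \<in> carrier G"
  shows "(\<lambda>b \<in> carrier G. a \<otimes> b \<otimes> inv a) \<in> auto G"
proof -
  have "bij_betw (\<lambda>b. a \<otimes> b \<otimes> inv a) (carrier G) (carrier G)"
    by (rule bij_betw_byWitness [where f' = "\<lambda>b. inv a \<otimes> b \<otimes> a"])
      (use a in \<open>auto simp: word_simps\<close>)
  then show ?thesis
    using a by (auto simp: auto_def Bij_def hom_def word_simps)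
qed

text \<open>The model for \<open>act_hom\<close>: after lifting, the derived action is this
  map.\<close>

lemma (in group) conjugation_hom_AutoGroup:
  "(\<lambda>a. \<lambda>b \<in> carrier G. a \<otimes> b \<otimes> inv a) \<in> hom G (AutoGroup G)"
proof (rule homI)
  show "(\<lambda>b \<in> carrier G. a \<otimes> b \<otimes> inv a) \<in> carrier (AutoGroup G)" if "a \<in> carrier G" for a
    using conjugation_in_auto [OF that] by (simp add: AutoGroup_def)
next
  fix a c
  assume ac: "a \<in> carrier G" "c \<in> carrier G"
  then have "(\<lambda>b \<in> carrier G. a \<otimes> b \<otimes> inv a) \<in> Bij (carrier G)"
    and "(\<lambda>b \<in> carrier G. c \<otimes> b \<otimes> inv c) \<in> Bij (carrier G)"
    using conjugation_in_auto by (simp_all add: auto_def)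
  then show "(\<lambda>b \<in> carrier G. a \<otimes> c \<otimes> b \<otimes> inv (a \<otimes> c)) =
      (\<lambda>b \<in> carrier G. a \<otimes> b \<otimes> inv a) \<otimes>\<^bsub>AutoGroup G\<^esub> (\<lambda>b \<in> carrier G. c \<otimes> b \<otimes> inv c)"
    using ac by (auto simp: AutoGroup_def BijGroup_def compose_def word_simps fun_eq_iff)
qed

text \<open>R2 for the crossed module given by the identity of \<open>G\<close> and conjugation. The
  arc reduces to \<open>z = inv s b (inv a) s a\<close>, a generalized Alexander quandle operation;
  substituting it, all letters cancel.\<close>

lemma (in group) word_R2:
  assumes "a \<in> carrier G" "b \<in> carrier G" "s \<in> carrier G"
    and "z = crossing_arc G (\<lambda>p. p) (commutator G (b \<otimes> inv s) (a \<otimes> inv s)) a b"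
  shows "commutator G (b \<otimes> inv s) (a \<otimes> inv s) \<otimes>
    (commutator G a z \<otimes> commutator G (z \<otimes> inv a) s) = \<one>"
  using assms by (simp add: crossing_arc_def word_simps)

text \<open>R3 in the same model, with conjugation as the action. Once the arcs are substituted,
  both sides reduce to the same word in the free letters \<open>a\<close>, \<open>b\<close>,
  \<open>t\<close>, \<open>s\<close>.\<close>

lemma (in group) word_R3:
  fixes s
  defines "\<phi> \<equiv> \<lambda>l m. commutator G (m \<otimes> inv s) (l \<otimes> inv s)"
  assumes "a \<in> carrier G" "b \<in> carrier G" "t \<in> carrier G" "s \<in> carrier G"
    and "z = crossing_arc G (\<lambda>p. p) (\<phi> b a) b a"
    and "v = crossing_arc G (\<lambda>p. p) (\<phi> t b) t b"
    and "w = crossing_arc G (\<lambda>p. p) (\<phi> t a) t a"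
  shows "\<phi> b a \<otimes> (b \<otimes> \<phi> t z \<otimes> inv b) \<otimes> \<phi> t b =
    (a \<otimes> \<phi> t b \<otimes> inv a) \<otimes> \<phi> t a \<otimes> (t \<otimes> \<phi> v w \<otimes> inv t)"
  using assms by (simp add: crossing_arc_def word_simps)

lemma (in group) crossing_arc_id_closed:
  "\<lbrakk>p \<in> carrier G; a \<in> carrier G; b \<in> carrier G\<rbrakk> \<Longrightarrow> crossing_arc G (\<lambda>p. p) p a b \<in> carrier G"
  by (simp add: crossing_arc_def)

text \<open>Arcs between lifted elements come with an explicit lift, namely the arc for the identity
  boundary that occurs in \<open>word_R2\<close> and \<open>word_R3\<close>.\<close>

lemma (in group_hom) hom_crossing_arc:
  assumes "p \<in> carrier G" "a \<in> carrier G" "b \<in> carrier G"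
  shows "crossing_arc H h p (h a) (h b) = h (crossing_arc G (\<lambda>p. p) p a b)"
  using assms by (simp add: crossing_arc_def)

context braided_crossed_module
begin

lemma braided_act_hom:
  assumes "a \<in> carrier E" "e \<in> carrier E"
  shows "braided_act E G \<delta> br (\<delta> a) e = a \<otimes>\<^bsub>E\<^esub> e \<otimes>\<^bsub>E\<^esub> inv\<^bsub>E\<^esub> a"
  \<comment> \<open>Reversing \<open>hom_inv\<close> gathers the arguments of \<open>br\<close>
    under \<open>\<delta>\<close>, so that \<open>br_delta\<close> applies.\<close>
  using assms by (simp add: braided_act_def br_delta G.conjugation_eq_mult_commutator flip: hom_inv)

lemma braided_phi_hom:
  assumes "s \<in> carrier E" "a \<in> carrier E" "b \<in> carrier E"
  shows "braided_phi G br (\<delta> s) (\<delta> a) (\<delta> b) =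
    commutator E (b \<otimes>\<^bsub>E\<^esub> inv\<^bsub>E\<^esub> s) (a \<otimes>\<^bsub>E\<^esub> inv\<^bsub>E\<^esub> s)"
  using assms by (simp add: braided_phi_def br_delta flip: hom_inv hom_mult)

lemma braided_psi_hom:
  assumes "s \<in> carrier E" "a \<in> carrier E" "b \<in> carrier E"
  shows "braided_psi E G br (\<delta> s) (\<delta> a) (\<delta> b) =
    commutator E a b \<otimes>\<^bsub>E\<^esub> commutator E (b \<otimes>\<^bsub>E\<^esub> inv\<^bsub>E\<^esub> a) s"
  using assms by (simp add: braided_psi_def br_delta flip: hom_inv hom_mult)

end

locale surjective_braided_crossed_module = braided_crossed_module +
  assumes delta_surj: "\<delta> ` carrier E = carrier G"
begin

lemma lift_obtain:
  assumes "g \<in> carrier G"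
  obtains a where "a \<in> carrier E" "g = \<delta> a"
  using assms delta_surj by blast

lemma crossed_module_braided_act: "crossed_module E G \<delta> (braided_act E G \<delta> br)"
proof
  let ?act = "\<lambda>g. restrict (braided_act E G \<delta> br g) (carrier E)"
  let ?conj = "\<lambda>a. \<lambda>b \<in> carrier E. a \<otimes>\<^bsub>E\<^esub> b \<otimes>\<^bsub>E\<^esub> inv\<^bsub>E\<^esub> a"
  \<comment> \<open>The left side depends only on \<open>\<delta> a\<close>, so the choice of lift
    is immaterial.\<close>
  have act_eq: "?act (\<delta> a) = ?conj a" if "a \<in> carrier E" for a
    using that by (auto simp: braided_act_hom)
  show "?act \<in> hom G (AutoGroup E)"
  proof (rule homI)
    fix g assume "g \<in> carrier G"
    then obtain a where "a \<in> carrier E" "g = \<delta> a" by (rule lift_obtain)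
    then show "?act g \<in> carrier (AutoGroup E)"
      using G.conjugation_hom_AutoGroup act_eq by (simp add: hom_def Pi_iff)
  next
    fix g k assume "g \<in> carrier G" "k \<in> carrier G"
    then obtain a c where ac: "a \<in> carrier E" "g = \<delta> a" "c \<in> carrier E" "k = \<delta> c"
      by (metis lift_obtain)
    then show "?act (g \<otimes>\<^bsub>G\<^esub> k) = ?act g \<otimes>\<^bsub>AutoGroup E\<^esub> ?act k"
      \<comment> \<open>The product \<open>a c\<close> serves as the lift of
        \<open>g k\<close>.\<close>
      using Group.hom_mult [OF G.conjugation_hom_AutoGroup, of a c]
      by (simp add: act_eq flip: hom_mult)
  qed
next
  fix g e assume "g \<in> carrier G" and e: "e \<in> carrier E"
  then obtain a where "a \<in> carrier E" "g = \<delta> a" by (metis lift_obtain)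
  with e show "\<delta> (braided_act E G \<delta> br g e) = g \<otimes>\<^bsub>G\<^esub> \<delta> e \<otimes>\<^bsub>G\<^esub> inv\<^bsub>G\<^esub> g"
    by (simp add: braided_act_hom)
qed (simp add: braided_act_hom)

lemma unframed_Reidemeister_pair_braided:
  assumes "x \<in> carrier G"
  shows "unframed_Reidemeister_pair E G \<delta> (braided_act E G \<delta> br)
    (braided_psi E G br x) (braided_phi G br x)"
proof -
  interpret crossed_module E G \<delta> "braided_act E G \<delta> br"
    by (rule crossed_module_braided_act)
  obtain s where s: "s \<in> carrier E" and x: "x = \<delta> s"
    using assms by (rule lift_obtain)
  \<comment> \<open>These rules push a Reidemeister condition into \<open>E\<close>: an arc becomes
    \<open>\<delta>\<close> of an element known to lie in \<open>E\<close>, so the formulas for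
    \<open>\<phi>\<close> and \<open>\<psi>\<close> apply again to \<open>Z\<close>,
    \<open>V\<close> and \<open>W\<close>.\<close>
  note [simp] = braided_phi_hom braided_psi_hom braided_act_hom hom_crossing_arc
    G.crossing_arc_id_closed
  show ?thesis
  proof
    show "braided_psi E G br x \<in> carrier G \<rightarrow> carrier G \<rightarrow> carrier E"
      using br_closed assms by (auto simp: braided_psi_def Pi_iff)
    show "braided_phi G br x \<in> carrier G \<rightarrow> carrier G \<rightarrow> carrier E"
      using br_closed assms by (auto simp: braided_phi_def Pi_iff)
  next
    fix X assume "X \<in> carrier G"
    then obtain a where "a \<in> carrier E" "X = \<delta> a" by (rule lift_obtain)
    then show "braided_psi E G br x X X = \<one>\<^bsub>E\<^esub>"
      using s by (simp add: x G.word_simps)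
  next
    fix X Y Z
    assume XY: "X \<in> carrier G" "Y \<in> carrier G"
      and Z: "Z = crossing_arc G \<delta> (braided_phi G br x X Y) X Y"
    from XY obtain a b where ab: "a \<in> carrier E" "X = \<delta> a" "b \<in> carrier E" "Y = \<delta> b"
      by (metis lift_obtain)
    then show "braided_phi G br x X Y \<otimes>\<^bsub>E\<^esub> braided_psi E G br x X Z = \<one>\<^bsub>E\<^esub>"
      \<comment> \<open>\<open>refl\<close> instantiates \<open>z\<close> with the arc in
        \<open>E\<close> itself, which is the lift of \<open>Z\<close>.\<close>
      using s G.word_R2 [OF ab(1,3) s refl] by (simp add: Z x)
  next
    fix X Y T Z V W
    assume XYT: "X \<in> carrier G" "Y \<in> carrier G" "T \<in> carrier G"
      and Z: "Z = crossing_arc G \<delta> (braided_phi G br x Y X) Y X"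
      and V: "V = crossing_arc G \<delta> (braided_phi G br x T Y) T Y"
      and W: "W = crossing_arc G \<delta> (braided_phi G br x T X) T X"
    from XYT obtain a b t where abt: "a \<in> carrier E" "X = \<delta> a" "b \<in> carrier E" "Y = \<delta> b"
        "t \<in> carrier E" "T = \<delta> t"
      by (metis lift_obtain)
    then show "braided_phi G br x Y X \<otimes>\<^bsub>E\<^esub> braided_act E G \<delta> br Y (braided_phi G br x T Z)
        \<otimes>\<^bsub>E\<^esub> braided_phi G br x T Y =
      braided_act E G \<delta> br X (braided_phi G br x T Y) \<otimes>\<^bsub>E\<^esub> braided_phi G br x T X
        \<otimes>\<^bsub>E\<^esub> braided_act E G \<delta> br T (braided_phi G br x V W)"
      using s G.word_R3 [OF abt(1,3,5) s refl refl refl] by (simp add: Z V W x)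
  qed
qed

text \<open>Beyond the Reidemeister pair, only the two boundary formulas remain; applying
  \<open>\<delta>\<close> to the definitions of \<open>\<phi>\<close> and \<open>\<psi>\<close>
  turns each bracket into a commutator by \<open>delta_br\<close>.\<close>

lemma unframed_Eisermann_lifting_braided:
  assumes x: "x \<in> carrier G"
  shows "unframed_Eisermann_lifting E G \<delta> (braided_act E G \<delta> br)
    (braided_psi E G br x) (braided_phi G br x) x"
proof -
  interpret unframed_Reidemeister_pair E G \<delta> "braided_act E G \<delta> br"
      "braided_psi E G br x" "braided_phi G br x"
    using x by (rule unframed_Reidemeister_pair_braided)
  have [simp]: "br g k \<in> carrier E" if "g \<in> carrier G" "k \<in> carrier G" for g k
    using that br_closed by blast
  show ?thesis
    by unfold_locales (use x in \<open>simp_all add: braided_phi_def braided_psi_def delta_br\<close>)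
qed

end

theorem theorem4p22:
  fixes E :: "('e, 'm) monoid_scheme" and G :: "('g, 'n) monoid_scheme"
    and \<delta> :: "'e \<Rightarrow> 'g" and br :: "'g \<Rightarrow> 'g \<Rightarrow> 'e" and x :: 'g
  assumes "braided_crossed_module E G \<delta> br"
    and "\<delta> ` carrier E = carrier G"
    and "x \<in> carrier G"
  shows "unframed_Reidemeister_pair E G \<delta> (braided_act E G \<delta> br)
           (braided_psi E G br x) (braided_phi G br x)
         \<and> unframed_Eisermann_lifting E G \<delta> (braided_act E G \<delta> br)
           (braided_psi E G br x) (braided_phi G br x) x"
proof -
  interpret surjective_braided_crossed_module E G \<delta> br
    using assms by (simp add: surjective_braided_crossed_module_def
        surjective_braided_crossed_module_axioms_def)
  show ?thesis
    using assms(3) by (simp add: unframed_Reidemeister_pair_braided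
        unframed_Eisermann_lifting_braided)
qed

end
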